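(* For all $\delta,\delta'\in\{\mathbf{CInd},\mathbf{T}\}$ we have $[\tau(\delta)\mathbf{Txt}\mathbf{G}\delta'\mathbf{Ex}_C]_{\mathbf{REC}} = [\tau(\delta)\mathcal{R}\mathbf{Txt}\mathbf{Psd}\delta'\mathbf{Ex}_C]_{\mathbf{REC}}$.
   Context: Fix an acceptable numbering $(\varphi_e)_{e\in\mathbb{N}}$ of all partial computable functions. A number $e$ is a $C$-index if $\varphi_e$ is total with values in $\{0,1\}$; then $C_e=\{x:\varphi_e(x)=1\}$. $\mathbf{REC}$ is the collection of recursive subsets of $\mathbb{N}$; $\mathcal{P}$ and $\mathcal{R}$ are the partial computable and total computable functions. Fix a pause symbol $\#$. A text is a total function $T:\mathbb{N}\to\mathbb{N}\cup\{\#\}$, $\mathrm{content}(T)=\mathrm{range}(T)\setminus\{\#\}$, $T$ is a text for $L$ if $\mathrm{content}(T)=L$, $T[n]=(T(0),\dots,T(n-1))$, and content of finite sequences is defined likewise. A learner is some $h\in\mathcal{P}$ (finite sequences/sets coded as numbers). Hypothesis sequences: full-information $\mathbf{G}(h,T)(i)=h(T[i])$; partially set-driven $\mathbf{Psd}(h,T)(i)=h(\mathrm{content}(T[i]),i)$. Restrictions on a hypothesis sequence $p$ and text $T$: $\mathbf{Ex}_C$: there is $n_0$ with $p(n)=p(n_0)$ for all $n\ge n_0$ and $p(n_0)$ a $C$-index with $C_{p(n_0)}=\mathrm{content}(T)$; $\mathbf{CInd}$: for all $i$, $p(i)$ is a $C$-index; $\mathbf{T}$: always true. Juxtaposition of restrictions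 means conjunction. For a set of admissible learners $\mathcal{C}\in\{\mathcal{P},\mathcal{R}\}$ (omitted means $\mathcal{P}$), a learner $h\in\mathcal{C}$ $\tau(\alpha)\mathcal{C}\mathbf{Txt}\beta\delta$-learns $L$ iff $\alpha(\beta(h,T),T)$ holds for every text $T$ whatsoever and $\delta(\beta(h,T),T)$ holds for every text $T$ for $L$ (omitting $\tau(\alpha)$ means $\alpha=\mathbf{T}$). $[\tau(\alpha)\mathcal{C}\mathbf{Txt}\beta\delta]_{\mathbf{REC}}$ is the set of all classes $\mathcal{L}\subseteq\mathbf{REC}$ for which some $h\in\mathcal{C}$ learns every $L\in\mathcal{L}$ in this sense. *)

theory Defs
  imports Main "HOL-Library.Nat_Bijection"
begin

section \<open>Partial computable functions\<close>

definition prim_rec :: "(nat list \<Rightarrow> nat option) \<Rightarrow> (nat list \<Rightarrow> nat option) \<Rightarrow> nat \<Rightarrow> nat list \<Rightarrow> nat option" where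
  "prim_rec f g k xs = rec_nat (f xs) (\<lambda>i r. Option.bind r (\<lambda>v. g (i # v # xs))) k"

text \<open>The search is undefined if it meets an undefined value before the first zero.\<close>
definition mu :: "(nat \<Rightarrow> nat option) \<Rightarrow> nat option" where
  "mu p = (if \<exists>y. p y = Some 0 \<and> (\<forall>z<y. p z \<noteq> None)
           then Some (LEAST y. p y = Some 0) else None)"

text \<open>\<open>mu_recursive n f\<close>: the restriction of \<open>f\<close> to lists of length \<open>n\<close> is an \<open>n\<close>-ary
  partial recursive function. Values at lists of other lengths carry no meaning.\<close>
inductive mu_recursive :: "nat \<Rightarrow> (nat list \<Rightarrow> nat option) \<Rightarrow> bool" where
  zero: "mu_recursive n (\<lambda>xs. Some 0)"
| succ: "mu_recursive 1 (\<lambda>xs. Some (Suc (xs ! 0)))"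
| proj: "i < n \<Longrightarrow> mu_recursive n (\<lambda>xs. Some (xs ! i))"
| comp: "mu_recursive (length fs) g \<Longrightarrow> (\<And>f. f \<in> set fs \<Longrightarrow> mu_recursive n f) \<Longrightarrow>
    mu_recursive n (\<lambda>xs. Option.bind (those (map (\<lambda>f. f xs) fs)) g)"
| prec: "mu_recursive n f \<Longrightarrow> mu_recursive (Suc (Suc n)) g \<Longrightarrow>
    mu_recursive (Suc n) (\<lambda>xs. prim_rec f g (hd xs) (tl xs))"
| minim: "mu_recursive (Suc n) f \<Longrightarrow> mu_recursive n (\<lambda>xs. mu (\<lambda>y. f (y # xs)))"

definition Pcomp :: "(nat \<Rightarrow> nat option) set" where
  "Pcomp = {\<lambda>x. f [x] | f. mu_recursive 1 f}"

definition Rcomp :: "(nat \<Rightarrow> nat option) set" where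
  "Rcomp = {f \<in> Pcomp. \<forall>x. f x \<noteq> None}"

definition REC :: "nat set set" where
  "REC = {A. (\<lambda>x. Some (if x \<in> A then 1 else 0)) \<in> Rcomp}"

section \<open>Acceptable numberings\<close>

definition effective_numbering :: "(nat \<Rightarrow> nat \<Rightarrow> nat option) \<Rightarrow> bool" where
  "effective_numbering \<psi> \<longleftrightarrow> (\<lambda>z. case prod_decode z of (e, x) \<Rightarrow> \<psi> e x) \<in> Pcomp"

text \<open>Acceptability in the sense of Rogers: every effective numbering translates computably
  into \<open>\<phi>\<close>.\<close>
definition acceptable :: "(nat \<Rightarrow> nat \<Rightarrow> nat option) \<Rightarrow> bool" where
  "acceptable \<phi> \<longleftrightarrow> range \<phi> = Pcomp \<and> effective_numbering \<phi> \<and>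
     (\<forall>\<psi>. effective_numbering \<psi> \<longrightarrow>
        (\<exists>c. (\<lambda>e. Some (c e)) \<in> Rcomp \<and> (\<forall>e. \<psi> e = \<phi> (c e))))"

definition C_index :: "(nat \<Rightarrow> nat \<Rightarrow> nat option) \<Rightarrow> nat \<Rightarrow> bool" where
  "C_index \<phi> e \<longleftrightarrow> (\<forall>x. \<phi> e x \<in> {Some 0, Some 1})"

definition C_set :: "(nat \<Rightarrow> nat \<Rightarrow> nat option) \<Rightarrow> nat \<Rightarrow> nat set" where
  "C_set \<phi> e = {x. \<phi> e x = Some 1}"

section \<open>Texts and hypothesis sequences\<close>

text \<open>In a text, \<open>None\<close> is the pause symbol; in a hypothesis sequence, \<open>None\<close> means undefined.\<close>
type_synonym text_seq = "nat \<Rightarrow> nat option"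
type_synonym hyp_seq = "nat \<Rightarrow> nat option"
type_synonym restriction = "hyp_seq \<Rightarrow> text_seq \<Rightarrow> bool"
type_synonym interaction = "(nat \<Rightarrow> nat option) \<Rightarrow> text_seq \<Rightarrow> hyp_seq"

definition content :: "text_seq \<Rightarrow> nat set" where
  "content T = {x. Some x \<in> range T}"

definition text_for :: "text_seq \<Rightarrow> nat set \<Rightarrow> bool" where
  "text_for T L \<longleftrightarrow> content T = L"

definition initial_segment :: "text_seq \<Rightarrow> nat \<Rightarrow> nat option list" where
  "initial_segment T n = map T [0..<n]"

definition content_seq :: "nat option list \<Rightarrow> nat set" where
  "content_seq \<sigma> = {x. Some x \<in> set \<sigma>}"

definition seq_code :: "nat option list \<Rightarrow> nat" where
  "seq_code \<sigma> = list_encode (map (\<lambda>a. case a of None \<Rightarrow> 0 | Some x \<Rightarrow> Suc x) \<sigma>)"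

definition G :: interaction where
  "G h T i = h (seq_code (initial_segment T i))"

definition Psd :: interaction where
  "Psd h T i = h (prod_encode (set_encode (content_seq (initial_segment T i)), i))"

section \<open>Learning criteria\<close>

definition Ex_C :: "(nat \<Rightarrow> nat \<Rightarrow> nat option) \<Rightarrow> restriction" where
  "Ex_C \<phi> p T \<longleftrightarrow> (\<exists>n0. (\<forall>n\<ge>n0. p n = p n0) \<and>
     (\<exists>e. p n0 = Some e \<and> C_index \<phi> e \<and> C_set \<phi> e = content T))"

definition CInd :: "(nat \<Rightarrow> nat \<Rightarrow> nat option) \<Rightarrow> restriction" where
  "CInd \<phi> p T \<longleftrightarrow> (\<forall>i. \<exists>e. p i = Some e \<and> C_index \<phi> e)"

definition Unrestricted :: restriction where
  "Unrestricted p T \<longleftrightarrow> True"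

definition restr_conj :: "restriction \<Rightarrow> restriction \<Rightarrow> restriction" where
  "restr_conj \<delta> \<delta>' p T \<longleftrightarrow> \<delta> p T \<and> \<delta>' p T"

definition learns :: "restriction \<Rightarrow> interaction \<Rightarrow> restriction \<Rightarrow> (nat \<Rightarrow> nat option) \<Rightarrow> nat set \<Rightarrow> bool" where
  "learns \<alpha> \<beta> \<delta> h L \<longleftrightarrow>
     (\<forall>T. \<alpha> (\<beta> h T) T) \<and> (\<forall>T. text_for T L \<longrightarrow> \<delta> (\<beta> h T) T)"

text \<open>\<open>Txt_REC \<alpha> \<C> \<beta> \<delta>\<close> is the class written \<open>[\<tau>(\<alpha>)\<C>Txt\<beta>\<delta>]\<close> with subscript \<open>REC\<close>.\<close>
definition Txt_REC ::
  "restriction \<Rightarrow> (nat \<Rightarrow> nat option) set \<Rightarrow> interaction \<Rightarrow> restriction \<Rightarrow> nat set set set" where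
  "Txt_REC \<alpha> \<C> \<beta> \<delta> = {\<L>. \<L> \<subseteq> REC \<and> (\<exists>h\<in>\<C>. \<forall>L\<in>\<L>. learns \<alpha> \<beta> \<delta> h L)}"

end

theory Submission
  imports Defs "HOL-Library.Sublist" "HOL.Filter"
begin

text \<open>The set-driven learner, given the content \<open>D\<close> of the first \<open>t\<close> data, approximates the given
  learner \<open>h\<close> by \<open>t\<close> stages of computation and searches for the least code \<open>s < t\<close> of a sequence over
  \<open>D\<close> on which \<open>h\<close> has already converged and which no extension over \<open>D\<close> with code below \<open>t\<close> is yet
  seen to contradict; it outputs \<open>h s\<close>, or a fixed C-index if there is no such \<open>s\<close>. On a text for a
  learned language the search converges, because a locking sequence is never refuted and every
  wrong candidate eventually is. Every output is the fixed index or a value of \<open>h\<close> on a sequence over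
  the content of the text, so \<open>CInd\<close> is inherited. Only stagewise approximations of a single
  function are used, and these exist by induction on its definition, without a universal function.\<close>

section \<open>Total recursive functions\<close>

text \<open>Recursiveness is only a condition on arguments of the right length, because
  \<^const>\<open>mu_recursive\<close> is not closed under changing values at other lists.\<close>
definition total_recursive :: "nat \<Rightarrow> (nat list \<Rightarrow> nat) \<Rightarrow> bool" where
  "total_recursive n f \<longleftrightarrow>
     (\<exists>g. mu_recursive n g \<and> (\<forall>xs. length xs = n \<longrightarrow> g xs = Some (f xs)))"

text \<open>A vector is the argument list handed to a function being composed. Requiring
  recursiveness componentwise lets such a list be analysed along its \<open>Cons\<close> and
  \<open>tl\<close> structure.\<close>

definition recursive_vector :: "nat \<Rightarrow> nat \<Rightarrow> (nat list \<Rightarrow> nat list) \<Rightarrow> bool" where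
  "recursive_vector n m b \<longleftrightarrow> (\<forall>xs. length xs = n \<longrightarrow> length (b xs) = m) \<and>
     (\<forall>i<m. total_recursive n (\<lambda>xs. b xs ! i))"

definition recursive_pred :: "nat \<Rightarrow> (nat list \<Rightarrow> bool) \<Rightarrow> bool" where
  "recursive_pred n P \<longleftrightarrow> total_recursive n (\<lambda>xs. of_bool (P xs))"

text \<open>The rules mostly speak of arbitrary recursive arguments in place of variables, so that
  backward application follows the syntax of a compound term.\<close>

named_theorems recursive_intros

lemma total_recursiveI:
  "mu_recursive n g \<Longrightarrow> (\<And>xs. length xs = n \<Longrightarrow> g xs = Some (f xs)) \<Longrightarrow> total_recursive n f"
  unfolding total_recursive_def by blast

lemma total_recursive_cong:
  assumes "total_recursive n f" "\<And>xs. length xs = n \<Longrightarrow> f xs = g xs"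
  shows "total_recursive n g"
  using assms unfolding total_recursive_def by metis

lemma recursive_pred_cong:
  assumes "recursive_pred n P" "\<And>xs. length xs = n \<Longrightarrow> P xs \<longleftrightarrow> Q xs"
  shows "recursive_pred n Q"
  using assms(1) unfolding recursive_pred_def
  by (rule total_recursive_cong) (simp add: assms(2))

section \<open>Composition and argument vectors\<close>

lemma those_eq_Some: "those ys = Some vs \<longleftrightarrow> ys = map Some vs"
  by (induction ys arbitrary: vs) (auto split: option.splits)

text \<open>Each component of \<open>b\<close> has its own witness; listed as
  \<open>map c [0..<m]\<close> these feed the composition scheme. On arguments of the right length
  all of them are defined, so \<open>those\<close> cannot fail.\<close>

lemma total_recursive_compose:
  assumes "total_recursive m f" "recursive_vector n m b"
  shows "total_recursive n (\<lambda>xs. f (b xs))"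
proof -
  obtain g where g: "mu_recursive m g" "\<And>xs. length xs = m \<Longrightarrow> g xs = Some (f xs)"
    using assms(1) unfolding total_recursive_def by blast
  have "\<forall>i<m. \<exists>c. mu_recursive n c \<and> (\<forall>xs. length xs = n \<longrightarrow> c xs = Some (b xs ! i))"
    using assms(2) unfolding recursive_vector_def total_recursive_def by blast
  then obtain c where c: "\<And>i. i < m \<Longrightarrow> mu_recursive n (c i)"
    "\<And>i xs. i < m \<Longrightarrow> length xs = n \<Longrightarrow> c i xs = Some (b xs ! i)"
    by metis
  have len: "length xs = n \<Longrightarrow> length (b xs) = m" for xs
    using assms(2) unfolding recursive_vector_def by blast
  let ?fs = "map c [0..<m]"
  show ?thesis
  proof (rule total_recursiveI)
    show "mu_recursive n (\<lambda>xs. Option.bind (those (map (\<lambda>f. f xs) ?fs)) g)"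
      by (rule mu_recursive.comp) (use g(1) c(1) in auto)
    fix xs :: "nat list" assume xs: "length xs = n"
    have "map (\<lambda>f. f xs) ?fs = map Some (b xs)"
      by (rule nth_equalityI) (simp_all add: c(2) len xs)
    then have "those (map (\<lambda>f. f xs) ?fs) = Some (b xs)"
      by (simp only: those_eq_Some)
    then show "Option.bind (those (map (\<lambda>f. f xs) ?fs)) g = Some (f (b xs))"
      using g(2) len xs by simp
  qed
qed

lemma recursive_vector_compose:
  assumes "recursive_vector n m c" "recursive_vector k n d"
  shows "recursive_vector k m (\<lambda>xs. c (d xs))"
proof -
  have "total_recursive k (\<lambda>xs. c (d xs) ! i)" if "i < m" for i
    using assms(1) that by (intro total_recursive_compose[OF _ assms(2)]) (simp add: recursive_vector_def)
  with assms show ?thesis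
    by (simp add: recursive_vector_def)
qed

lemma recursive_vector_id [recursive_intros]: "recursive_vector n n (\<lambda>xs. xs)"
  unfolding recursive_vector_def
  by (auto intro!: total_recursiveI mu_recursive.proj)

lemma recursive_vector_Nil [recursive_intros]: "recursive_vector n 0 (\<lambda>xs. [])"
  unfolding recursive_vector_def by simp

lemma recursive_vector_Cons [recursive_intros]:
  assumes "total_recursive n a" "recursive_vector n m b"
  shows "recursive_vector n (Suc m) (\<lambda>xs. a xs # b xs)"
  using assms unfolding recursive_vector_def by (auto simp: less_Suc_eq_0_disj)

text \<open>Recursion and search put new variables in front of the parameters, which from then on
  appear as tails of the argument list.\<close>

lemma recursive_vector_tl [recursive_intros]:
  assumes "recursive_vector n (Suc m) b"
  shows "recursive_vector n m (\<lambda>xs. tl (b xs))"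
proof -
  have len: "length xs = n \<Longrightarrow> length (b xs) = Suc m" for xs
    using assms by (simp add: recursive_vector_def)
  have nth: "i \<le> m \<Longrightarrow> total_recursive n (\<lambda>xs. b xs ! i)" for i
    using assms by (simp add: recursive_vector_def)
  have "total_recursive n (\<lambda>xs. tl (b xs) ! i)" if "i < m" for i
    by (rule total_recursive_cong[OF nth[of "Suc i"]]) (use that len in \<open>simp_all add: nth_tl\<close>)
  then show ?thesis
    by (simp add: recursive_vector_def len)
qed

lemma recursive_vector_map:
  assumes "\<And>f. f \<in> set fs \<Longrightarrow> total_recursive n (c f)"
  shows "recursive_vector n (length fs) (\<lambda>xs. map (\<lambda>f. c f xs) fs)"
  using assms by (auto simp: recursive_vector_def)

text \<open>The three forms serve terms with no, one or two new variables in front of the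
  parameters: search adds one, primitive recursion two.\<close>

lemma total_recursive_nth [recursive_intros]:
  "i < n \<Longrightarrow> total_recursive n (\<lambda>xs. xs ! i)"
  "i < n - 1 \<Longrightarrow> total_recursive n (\<lambda>xs. tl xs ! i)"
  "i < n - 2 \<Longrightarrow> total_recursive n (\<lambda>xs. tl (tl xs) ! i)"
proof -
  show "i < n \<Longrightarrow> total_recursive n (\<lambda>xs. xs ! i)" for n i
    using recursive_vector_id[of n] unfolding recursive_vector_def by blast
  note tl = this[THEN total_recursive_cong]
  show "i < n - 1 \<Longrightarrow> total_recursive n (\<lambda>xs. tl xs ! i)"
    by (rule tl[of "Suc i"]) (auto simp: nth_tl)
  show "i < n - 2 \<Longrightarrow> total_recursive n (\<lambda>xs. tl (tl xs) ! i)"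
    by (rule tl[of "Suc (Suc i)"]) (auto simp: nth_tl)
qed

section \<open>Primitive recursion and arithmetic\<close>

lemma total_recursive_Suc [recursive_intros]:
  assumes "total_recursive n a"
  shows "total_recursive n (\<lambda>xs. Suc (a xs))"
proof -
  have "total_recursive 1 (\<lambda>xs. Suc (xs ! 0))"
    by (rule total_recursiveI[OF mu_recursive.succ]) simp
  moreover have "recursive_vector n 1 (\<lambda>xs. [a xs])"
    using assms by (auto simp: recursive_vector_def)
  ultimately show ?thesis
    using total_recursive_compose by fastforce
qed

lemma total_recursive_const [recursive_intros]: "total_recursive n (\<lambda>xs. c)"
  by (induction c) (auto intro: total_recursiveI[OF mu_recursive.zero] recursive_intros)

text \<open>The premise on \<open>g\<close> reads counter, previous value and parameters off one
  list, in the order in which \<open>prim_rec\<close> supplies them. Since \<open>f\<close> and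
  \<open>g\<close> are total, induction on the counter shows that no step is undefined.\<close>

lemma total_recursive_rec_nat [recursive_intros]:
  assumes f: "total_recursive n f" and g: "total_recursive (Suc (Suc n)) (\<lambda>ys. g (ys ! 0) (ys ! 1) (tl (tl ys)))"
    and k: "total_recursive n k"
  shows "total_recursive n (\<lambda>xs. rec_nat (f xs) (\<lambda>i r. g i r xs) (k xs))"
proof -
  obtain f' where f': "mu_recursive n f'" "\<And>xs. length xs = n \<Longrightarrow> f' xs = Some (f xs)"
    using f unfolding total_recursive_def by blast
  obtain g' where g': "mu_recursive (Suc (Suc n)) g'"
    "\<And>ys. length ys = Suc (Suc n) \<Longrightarrow> g' ys = Some (g (ys ! 0) (ys ! 1) (tl (tl ys)))"
    using g unfolding total_recursive_def by blast
  have eval: "prim_rec f' g' i xs = Some (rec_nat (f xs) (\<lambda>i r. g i r xs) i)" if "length xs = n" for i xs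
    using that by (induction i) (auto simp: prim_rec_def f' g')
  have "total_recursive (Suc n) (\<lambda>ys. rec_nat (f (tl ys)) (\<lambda>i r. g i r (tl ys)) (hd ys))"
    by (rule total_recursiveI[OF mu_recursive.prec[OF f'(1) g'(1)]]) (simp add: eval)
  moreover have "recursive_vector n (Suc n) (\<lambda>xs. k xs # xs)"
    using k by (intro recursive_intros)
  ultimately show ?thesis
    using total_recursive_compose by fastforce
qed

text \<open>A recursion that ignores the previous value and returns its counter computes the
  predecessor, with \<open>0\<close> as the predecessor of \<open>0\<close>.\<close>

lemma total_recursive_diff_one [recursive_intros]:
  assumes "total_recursive n a"
  shows "total_recursive n (\<lambda>xs. a xs - 1)"
proof -
  have eq: "rec_nat 0 (\<lambda>i r. i) (a xs) = a xs - 1" for xs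
    by (cases "a xs") auto
  have "total_recursive n (\<lambda>xs. rec_nat 0 (\<lambda>i r. i) (a xs))"
    using assms by (intro recursive_intros) simp_all
  then show ?thesis by (simp only: eq)
qed

lemma total_recursive_add [recursive_intros]:
  assumes "total_recursive n a" "total_recursive n b"
  shows "total_recursive n (\<lambda>xs. a xs + b xs)"
proof -
  have eq: "rec_nat x (\<lambda>i r. Suc r) y = x + y" for x y :: nat
    by (induction y) auto
  have "total_recursive n (\<lambda>xs. rec_nat (a xs) (\<lambda>i r. Suc r) (b xs))"
    using assms by (intro recursive_intros) simp_all
  then show ?thesis by (simp only: eq)
qed

lemma total_recursive_diff [recursive_intros]:
  assumes "total_recursive n a" "total_recursive n b"
  shows "total_recursive n (\<lambda>xs. a xs - b xs)"
proof -
  have eq: "rec_nat x (\<lambda>i r. r - 1) y = x - y" for x y :: nat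
    by (induction y) auto
  have "total_recursive n (\<lambda>xs. rec_nat (a xs) (\<lambda>i r. r - 1) (b xs))"
    using assms by (intro recursive_intros) simp_all
  then show ?thesis by (simp only: eq)
qed

lemma total_recursive_mult [recursive_intros]:
  assumes "total_recursive n a" "total_recursive n b"
  shows "total_recursive n (\<lambda>xs. a xs * b xs)"
proof -
  have eq: "rec_nat 0 (\<lambda>i r. r + x) y = x * y" for x y :: nat
    by (induction y) auto
  have "total_recursive n (\<lambda>xs. rec_nat 0 (\<lambda>i r. r + a xs) (b xs))"
    by (intro recursive_intros assms total_recursive_compose[OF assms(1)]) simp_all
  then show ?thesis by (simp only: eq)
qed

lemma total_recursive_power [recursive_intros]:
  assumes "total_recursive n a" "total_recursive n b"
  shows "total_recursive n (\<lambda>xs. a xs ^ b xs)"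
proof -
  have eq: "rec_nat 1 (\<lambda>i r. r * x) y = x ^ y" for x y :: nat
    by (induction y) auto
  have "total_recursive n (\<lambda>xs. rec_nat 1 (\<lambda>i r. r * a xs) (b xs))"
    by (intro recursive_intros assms total_recursive_compose[OF assms(1)]) simp_all
  then show ?thesis by (simp only: eq)
qed

lemma total_recursive_triangle [recursive_intros]:
  assumes "total_recursive n a"
  shows "total_recursive n (\<lambda>xs. triangle (a xs))"
proof -
  have eq: "rec_nat 0 (\<lambda>i r. r + Suc i) x = triangle x" for x
    by (induction x) auto
  have "total_recursive n (\<lambda>xs. rec_nat 0 (\<lambda>i r. r + Suc i) (a xs))"
    using assms by (intro recursive_intros) simp_all
  then show ?thesis by (simp only: eq)
qed

section \<open>Case distinction and decidable predicates\<close>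

lemma total_recursive_if [recursive_intros]:
  assumes "recursive_pred n P" "total_recursive n a" "total_recursive n b"
  shows "total_recursive n (\<lambda>xs. if P xs then a xs else b xs)"
proof (rule total_recursive_cong)
  \<comment> \<open>The truth value is the number of recursion steps: none leaves
    \<open>b xs\<close>, one returns \<open>a xs\<close>.\<close>
  show "total_recursive n (\<lambda>xs. rec_nat (b xs) (\<lambda>i r. a xs) (of_bool (P xs)))"
    by (intro recursive_intros assms assms(1)[unfolded recursive_pred_def]
        total_recursive_compose[OF assms(2)])
qed simp

lemma recursive_pred_not [recursive_intros]:
  assumes "recursive_pred n P"
  shows "recursive_pred n (\<lambda>xs. \<not> P xs)"
  unfolding recursive_pred_def
  by (rule total_recursive_cong[where f = "\<lambda>xs. if P xs then 0 else 1"])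
    (intro recursive_intros assms, simp)

lemma recursive_pred_conj [recursive_intros]:
  assumes "recursive_pred n P" "recursive_pred n Q"
  shows "recursive_pred n (\<lambda>xs. P xs \<and> Q xs)"
  unfolding recursive_pred_def
  by (rule total_recursive_cong[where f = "\<lambda>xs. if P xs then if Q xs then 1 else 0 else 0"])
    (intro recursive_intros assms, simp)

lemma recursive_pred_disj [recursive_intros]:
  assumes "recursive_pred n P" "recursive_pred n Q"
  shows "recursive_pred n (\<lambda>xs. P xs \<or> Q xs)"
  using recursive_pred_not[OF recursive_pred_conj[OF assms[THEN recursive_pred_not]]] by simp

lemma recursive_pred_imp [recursive_intros]:
  assumes "recursive_pred n P" "recursive_pred n Q"
  shows "recursive_pred n (\<lambda>xs. P xs \<longrightarrow> Q xs)"
  using recursive_pred_disj[OF recursive_pred_not[OF assms(1)] assms(2)] by (simp only: imp_conv_disj)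

lemma recursive_pred_less [recursive_intros]:
  assumes "total_recursive n a" "total_recursive n b"
  shows "recursive_pred n (\<lambda>xs. a xs < b xs)"
  unfolding recursive_pred_def
proof (rule total_recursive_cong)
  \<comment> \<open>With truncated subtraction, \<open>b xs - a xs\<close> is positive exactly if
    \<open>a xs < b xs\<close>, and \<open>1 - (1 - x)\<close> is the sign of
    \<open>x\<close>.\<close>
  show "total_recursive n (\<lambda>xs. 1 - (1 - (b xs - a xs)))"
    by (intro recursive_intros assms)
qed simp

lemma recursive_pred_le [recursive_intros]:
  assumes "total_recursive n a" "total_recursive n b"
  shows "recursive_pred n (\<lambda>xs. a xs \<le> b xs)"
  using recursive_pred_not[OF recursive_pred_less[OF assms(2,1)]] by (simp add: not_less)

lemma recursive_pred_eq [recursive_intros]: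
  assumes "total_recursive n a" "total_recursive n b"
  shows "recursive_pred n (\<lambda>xs. a xs = b xs)"
  using recursive_pred_conj[OF recursive_pred_le[OF assms] recursive_pred_le[OF assms(2,1)]]
  by (simp add: eq_iff)

section \<open>Search and bounded quantifiers\<close>

lemma total_recursive_Least:
  assumes P: "recursive_pred (Suc n) (\<lambda>ys. P (ys ! 0) (tl ys))"
    and ex: "\<And>xs. length xs = n \<Longrightarrow> \<exists>y. P y xs"
  shows "total_recursive n (\<lambda>xs. LEAST y. P y xs)"
proof -
  \<comment> \<open>\<open>mu\<close> looks for a zero, hence the negation: the truth value of the
    negated predicate is \<open>0\<close> exactly where \<open>P\<close> holds.\<close>
  obtain g where g: "mu_recursive (Suc n) g"
    "\<And>ys. length ys = Suc n \<Longrightarrow> g ys = Some (of_bool (\<not> P (ys ! 0) (tl ys)))"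
    using recursive_pred_not[OF P] unfolding recursive_pred_def total_recursive_def by blast
  show ?thesis
  proof (rule total_recursiveI[OF mu_recursive.minim[OF g(1)]])
    fix xs :: "nat list" assume xs: "length xs = n"
    have "g (y # xs) = Some (of_bool (\<not> P y xs))" for y
      using g(2)[of "y # xs"] xs by simp
    then show "mu (\<lambda>y. g (y # xs)) = Some (LEAST y. P y xs)"
      using ex[OF xs] by (simp add: mu_def)
  qed
qed

text \<open>The search stops at a witness or at the bound, whichever comes first, so it is total; a
  witness exists exactly if it stops before the bound.\<close>

lemma recursive_pred_bex [recursive_intros]:
  assumes P: "recursive_pred (Suc n) (\<lambda>ys. P (ys ! 0) (tl ys))" and b: "total_recursive n b"
  shows "recursive_pred n (\<lambda>xs. \<exists>y<b xs. P y xs)"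
proof (rule recursive_pred_cong)
  have "total_recursive n (\<lambda>xs. LEAST y. P y xs \<or> b xs \<le> y)"
    by (rule total_recursive_Least)
      (auto intro!: recursive_intros P total_recursive_compose[OF b])
  then show "recursive_pred n (\<lambda>xs. (LEAST y. P y xs \<or> b xs \<le> y) < b xs)"
    by (intro recursive_intros b)
  fix xs
  show "(LEAST y. P y xs \<or> b xs \<le> y) < b xs \<longleftrightarrow> (\<exists>y<b xs. P y xs)"
  proof
    assume "(LEAST y. P y xs \<or> b xs \<le> y) < b xs"
    then show "\<exists>y<b xs. P y xs"
      using LeastI[of "\<lambda>y. P y xs \<or> b xs \<le> y" "b xs"] by auto
  next
    assume "\<exists>y<b xs. P y xs"
    then show "(LEAST y. P y xs \<or> b xs \<le> y) < b xs"
      by (auto intro: le_less_trans[OF Least_le])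
  qed
qed

lemma recursive_pred_ball [recursive_intros]:
  assumes "recursive_pred (Suc n) (\<lambda>ys. P (ys ! 0) (tl ys))" "total_recursive n b"
  shows "recursive_pred n (\<lambda>xs. \<forall>y<b xs. P y xs)"
  using recursive_pred_not[OF recursive_pred_bex[OF recursive_pred_not[OF assms(1)] assms(2)]] by simp

text \<open>Parity and division are wanted because membership in \<open>set_decode\<close> tests a
  binary digit of the code.\<close>

lemma recursive_pred_even [recursive_intros]:
  assumes "total_recursive n a"
  shows "recursive_pred n (\<lambda>xs. even (a xs))"
proof (rule recursive_pred_cong)
  show "recursive_pred n (\<lambda>xs. \<exists>k<Suc (a xs). a xs = 2 * k)"
    by (intro recursive_intros assms total_recursive_compose[OF assms]) simp_all
qed (auto simp: dvd_def)

lemma total_recursive_div [recursive_intros]: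
  assumes "total_recursive n a" "total_recursive n b"
  shows "total_recursive n (\<lambda>xs. a xs div b xs)"
proof (rule total_recursive_cong)
  have ex: "\<exists>q. y = 0 \<or> x < Suc q * y" for x y :: nat
    by (rule exI[of _ x], cases y) auto
  \<comment> \<open>The quotient is the least \<open>q\<close> whose successor times the divisor
    exceeds the dividend. For divisor \<open>0\<close> the first disjunct ends the search at
    \<open>0\<close>, the value that \<open>div\<close> has there.\<close>
  show "total_recursive n (\<lambda>xs. LEAST q. b xs = 0 \<or> a xs < Suc q * b xs)"
    by (rule total_recursive_Least)
      (intro recursive_intros total_recursive_compose[OF assms(1)] total_recursive_compose[OF assms(2)] ex; simp)+
  have "(LEAST q. y = 0 \<or> x < Suc q * y) = x div y" for x y :: nat
  proof (cases "y = 0")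
    case False
    then have "x < Suc (x div y) * y"
      using dividend_less_div_times[of y x] by simp
    moreover have "x div y \<le> q" if "x < Suc q * y" for q
      using less_mult_imp_div_less[OF that] by simp
    ultimately show ?thesis
      using False by (intro Least_equality) blast+
  qed (simp add: Least_equality)
  then show "(LEAST q. b xs = 0 \<or> a xs < Suc q * b xs) = a xs div b xs" for xs
    by blast
qed

section \<open>Approximating partial recursive functions\<close>

text \<open>\<open>F t xs\<close> is \<open>Suc v\<close> if the value \<open>v\<close> has been found by stage \<open>t\<close>, and \<open>0\<close> if nothing has.\<close>
definition stage_approx :: "nat \<Rightarrow> (nat list \<Rightarrow> nat option) \<Rightarrow> (nat \<Rightarrow> nat list \<Rightarrow> nat) \<Rightarrow> bool" where
  "stage_approx n f F \<longleftrightarrow> total_recursive (Suc n) (\<lambda>ys. F (ys ! 0) (tl ys)) \<and>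
     (\<forall>xs. length xs = n \<longrightarrow>
        (\<forall>t v. F t xs = Suc v \<longrightarrow> f xs = Some v) \<and>
        (\<forall>v. f xs = Some v \<longrightarrow> (\<forall>\<^sub>F t in sequentially. F t xs = Suc v)))"

lemma stage_approx_compose:
  assumes "stage_approx n f F" "total_recursive m a" "recursive_vector m n b"
  shows "total_recursive m (\<lambda>xs. F (a xs) (b xs))"
  using total_recursive_compose[OF _ recursive_vector_Cons[OF assms(2,3)], of "\<lambda>ys. F (ys ! 0) (tl ys)"]
    assms(1) unfolding stage_approx_def by simp

lemma stage_approx_sound:
  "stage_approx n f F \<Longrightarrow> length xs = n \<Longrightarrow> F t xs = Suc v \<Longrightarrow> f xs = Some v"
  unfolding stage_approx_def by blast

lemma stage_approx_complete:
  "stage_approx n f F \<Longrightarrow> length xs = n \<Longrightarrow> f xs = Some v \<Longrightarrow>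
    \<forall>\<^sub>F t in sequentially. F t xs = Suc v"
  unfolding stage_approx_def by blast

lemma stage_approx_total:
  assumes "total_recursive n f"
  shows "stage_approx n (\<lambda>xs. Some (f xs)) (\<lambda>t xs. Suc (f xs))"
  unfolding stage_approx_def
  by (auto intro!: recursive_intros total_recursive_compose[OF assms])

lemma recursive_pred_bex_list:
  assumes "\<And>f. f \<in> set fs \<Longrightarrow> recursive_pred n (P f)"
  shows "recursive_pred n (\<lambda>xs. \<exists>f\<in>set fs. P f xs)"
  using assms
proof (induction fs)
  case Nil
  show ?case
    unfolding recursive_pred_def by (simp add: total_recursive_const)
next
  case (Cons f fs)
  then show ?case
    by (auto intro!: recursive_pred_disj)
qed

text \<open>Inner and outer computations run for the same number of stages, and an inner value not
  yet found makes the result \<open>0\<close>. For completeness, the finitely many inner values and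
  the outer value are all present from a common stage on.\<close>

lemma stage_approx_comp:
  assumes g: "stage_approx (length fs) g B" and fs: "\<And>f. f \<in> set fs \<Longrightarrow> stage_approx n f (A f)"
  shows "stage_approx n (\<lambda>xs. Option.bind (those (map (\<lambda>f. f xs) fs)) g)
    (\<lambda>t xs. if \<exists>f\<in>set fs. A f t xs = 0 then 0 else B t (map (\<lambda>f. A f t xs - 1) fs))"
    (is "stage_approx n ?f ?F")
  unfolding stage_approx_def
proof (intro conjI allI impI)
  show "total_recursive (Suc n) (\<lambda>ys. ?F (ys ! 0) (tl ys))"
    by (intro recursive_intros recursive_pred_bex_list recursive_vector_map
        stage_approx_compose[OF g] stage_approx_compose[OF fs]) simp_all
next
  fix xs :: "nat list" and t v assume xs: "length xs = n" and *: "?F t xs = Suc v"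
  from * have A: "A f t xs \<noteq> 0" if "f \<in> set fs" for f
    using that by (auto split: if_splits)
  have "f xs = Some (A f t xs - 1)" if "f \<in> set fs" for f
    using stage_approx_sound[OF fs[OF that] xs, of t "A f t xs - 1"] A[OF that] by simp
  then have "those (map (\<lambda>f. f xs) fs) = Some (map (\<lambda>f. A f t xs - 1) fs)"
    by (simp add: those_eq_Some)
  moreover have "g (map (\<lambda>f. A f t xs - 1) fs) = Some v"
    by (rule stage_approx_sound[OF g]) (use * in \<open>auto split: if_splits\<close>)
  ultimately show "?f xs = Some v"
    by simp
next
  fix xs :: "nat list" and v assume xs: "length xs = n" and *: "?f xs = Some v"
  then obtain vs where vs: "map (\<lambda>f. f xs) fs = map Some vs" "g vs = Some v"
    by (auto simp: those_eq_Some bind_eq_Some_conv)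
  from vs(1) have f: "f xs = Some (the (f xs))" if "f \<in> set fs" for f
  proof -
    have "f xs \<in> set (map Some vs)"
      unfolding vs(1)[symmetric] using that by simp
    then show ?thesis by auto
  qed
  have vs_eq: "vs = map (\<lambda>f. the (f xs)) fs"
    using arg_cong[OF vs(1), of "map the"] by (simp add: comp_def)
  have "\<forall>\<^sub>F t in sequentially. \<forall>f\<in>set fs. A f t xs = Suc (the (f xs))"
    by (intro eventually_ball_finite ballI stage_approx_complete[OF fs xs] f) simp_all
  moreover have "\<forall>\<^sub>F t in sequentially. B t vs = Suc v"
    by (rule stage_approx_complete[OF g _ vs(2)]) (simp add: vs_eq)
  ultimately show "\<forall>\<^sub>F t in sequentially. ?F t xs = Suc v"
  proof eventually_elim
    case (elim t)
    then have "map (\<lambda>f. A f t xs - 1) fs = vs"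
      by (simp add: vs_eq)
    moreover have "\<not> (\<exists>f\<in>set fs. A f t xs = 0)"
      using elim(1) by simp
    ultimately show ?case
      using elim(2) by (simp only: if_False)
  qed
qed

text \<open>The code \<open>0\<close> for a missing value is passed on through the recursion, and
  \<open>r - 1\<close> decodes a value that has been found. A fixed recursion depth involves only
  finitely many values, so induction on the depth gives both soundness and eventual
  convergence.\<close>

lemma stage_approx_prec:
  assumes f: "stage_approx n f A" and g: "stage_approx (Suc (Suc n)) g B"
  shows "stage_approx (Suc n) (\<lambda>xs. prim_rec f g (hd xs) (tl xs))
    (\<lambda>t xs. rec_nat (A t (tl xs)) (\<lambda>i r. if r = 0 then 0 else B t (i # (r - 1) # tl xs)) (xs ! 0))"
    (is "stage_approx _ ?f ?F")
  unfolding stage_approx_def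
proof (intro conjI allI impI)
  show "total_recursive (Suc (Suc n)) (\<lambda>ys. ?F (ys ! 0) (tl ys))"
    by (intro recursive_intros stage_approx_compose[OF f] stage_approx_compose[OF g]) simp_all
next
  let ?R = "\<lambda>t ys. rec_nat (A t ys) (\<lambda>i r. if r = 0 then 0 else B t (i # (r - 1) # ys))"
  fix xs :: "nat list" assume xs: "length xs = Suc n"
  then have ys: "length (tl xs) = n" and hd: "hd xs = xs ! 0"
    by (simp, cases xs) auto
  have "prim_rec f g k (tl xs) = Some v" if "?R t (tl xs) k = Suc v" for k t v
    using that
  proof (induction k arbitrary: v)
    case 0
    then show ?case using stage_approx_sound[OF f ys] by (simp add: prim_rec_def)
  next
    case (Suc k)
    then obtain r where r: "?R t (tl xs) k = Suc r"
      by (cases "?R t (tl xs) k") auto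
    with Suc.prems have "B t (k # r # tl xs) = Suc v" by simp
    then show ?case
      using Suc.IH[OF r] stage_approx_sound[OF g, of "k # r # tl xs" t v] ys
      by (simp add: prim_rec_def)
  qed
  then show "?f xs = Some v" if "?F t xs = Suc v" for t v
    using that by (simp add: hd)
  have "\<forall>\<^sub>F t in sequentially. ?R t (tl xs) k = Suc v" if "prim_rec f g k (tl xs) = Some v" for k v
    using that
  proof (induction k arbitrary: v)
    case 0
    then show ?case using stage_approx_complete[OF f ys] by (simp add: prim_rec_def)
  next
    case (Suc k)
    then obtain r where r: "prim_rec f g k (tl xs) = Some r" "g (k # r # tl xs) = Some v"
      by (auto simp: prim_rec_def bind_eq_Some_conv)
    have "\<forall>\<^sub>F t in sequentially. B t (k # r # tl xs) = Suc v"
      using stage_approx_complete[OF g _ r(2)] ys by simp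
    with Suc.IH[OF r(1)] show ?case
      by eventually_elim simp
  qed
  then show "\<forall>\<^sub>F t in sequentially. ?F t xs = Suc v" if "?f xs = Some v" for v
    using that by (simp add: hd)
qed

text \<open>The unbounded search is cut off at \<open>t\<close> and reads values of stage
  \<open>t\<close> only. A result counts only if all earlier values have been found to be positive,
  so a later stage cannot reveal a smaller zero.\<close>

lemma stage_approx_minim:
  assumes f: "stage_approx (Suc n) f A"
  shows "\<exists>F. stage_approx n (\<lambda>xs. mu (\<lambda>y. f (y # xs))) F"
proof -
  \<comment> \<open>The code \<open>1\<close> says that the value \<open>0\<close> has been found, a
    code above \<open>1\<close> that a positive value has. Hence at most one \<open>y\<close>
    satisfies \<open>Q t y xs\<close>.\<close>
  define Q where "Q t y xs \<longleftrightarrow> A t (y # xs) = 1 \<and> (\<forall>z<y. 1 < A t (z # xs))" for t y xs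
  \<comment> \<open>The disjunct \<open>t \<le> y\<close> only keeps the inner search total; its
    result is used only when a witness below \<open>t\<close> exists.\<close>
  define F where "F t xs = (if \<exists>y<t. Q t y xs then Suc (LEAST y. Q t y xs \<or> t \<le> y) else 0)" for t xs
  have Q_less: "recursive_pred m (\<lambda>xs. Q (a xs) (b xs) (c xs))"
    if "total_recursive m a" "total_recursive m b" "recursive_vector m n c" for m a b c
    unfolding Q_def
    by (intro recursive_intros stage_approx_compose[OF f] that
        total_recursive_compose[OF that(1)] recursive_vector_compose[OF that(3)])
      (use that in simp_all)
  have "stage_approx n (\<lambda>xs. mu (\<lambda>y. f (y # xs))) F"
    unfolding stage_approx_def
  proof (intro conjI allI impI)
    show "total_recursive (Suc n) (\<lambda>ys. F (ys ! 0) (tl ys))"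
      unfolding F_def
      by (intro recursive_intros Q_less total_recursive_Least) auto
  next
    fix xs :: "nat list" and t v assume xs: "length xs = n" and *: "F t xs = Suc v"
    let ?p = "\<lambda>y. f (y # xs)"
    from * have ex: "\<exists>y<t. Q t y xs" and v: "v = (LEAST y. Q t y xs \<or> t \<le> y)"
      by (auto simp: F_def split: if_splits)
    from ex obtain y where "y < t" "Q t y xs" by blast
    \<comment> \<open>The least solution of the disjunction is at most the witness below
      \<open>t\<close>, so it is a solution of the first disjunct.\<close>
    then have "Q t v xs"
      using LeastI[of "\<lambda>y. Q t y xs \<or> t \<le> y" y] Least_le[of "\<lambda>y. Q t y xs \<or> t \<le> y" y]
      unfolding v by auto
    then have v0: "?p v = Some 0"
      using stage_approx_sound[OF f, of "v # xs" t 0] xs by (simp add: Q_def)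
    have less: "\<exists>u. ?p z = Some (Suc u)" if "z < v" for z
    proof -
      have "1 < A t (z # xs)"
        using \<open>Q t v xs\<close> \<open>z < v\<close> unfolding Q_def by blast
      then obtain u where "A t (z # xs) = Suc (Suc u)"
        by (auto dest: less_imp_Suc_add)
      then show ?thesis
        using stage_approx_sound[OF f, of "z # xs"] xs by auto
    qed
    have "(LEAST y. ?p y = Some 0) = v"
    proof (rule Least_equality)
      show "v \<le> y" if "?p y = Some 0" for y
        using less[of y] that by (intro leI notI) auto
    qed (rule v0)
    moreover have "\<exists>y. ?p y = Some 0 \<and> (\<forall>z<y. ?p z \<noteq> None)"
      using v0 less by (intro exI[of _ v]) auto
    ultimately show "mu ?p = Some v"
      unfolding mu_def by simp
  next
    fix xs :: "nat list" and v assume xs: "length xs = n" and *: "mu (\<lambda>y. f (y # xs)) = Some v"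
    let ?p = "\<lambda>y. f (y # xs)"
    obtain y where y: "?p y = Some 0" "\<forall>z<y. ?p z \<noteq> None" and v: "v = (LEAST y. ?p y = Some 0)"
      using * by (auto simp: mu_def split: if_splits)
    from y(1) have v0: "?p v = Some 0"
      unfolding v by (rule LeastI)
    have "v \<le> y"
      unfolding v using y(1) by (rule Least_le)
    \<comment> \<open>Values before \<open>v\<close> are defined because \<open>v \<le> y\<close>,
      and positive because \<open>v\<close> is the least zero.\<close>
    with y(2) have less: "?p z = Some (the (?p z))" "0 < the (?p z)" if "z < v" for z
    proof -
      obtain u where "?p z = Some u"
        using y(2) \<open>v \<le> y\<close> \<open>z < v\<close> by force
      moreover have "?p z \<noteq> Some 0"
        using that unfolding v by (rule not_less_Least)
      ultimately show "?p z = Some (the (?p z))" "0 < the (?p z)"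
        by auto
    qed
    have "\<forall>\<^sub>F t in sequentially. \<forall>z\<in>{..<v}. A t (z # xs) = Suc (the (?p z))"
      by (intro eventually_ball_finite ballI stage_approx_complete[OF f] less(1)) (simp_all add: xs)
    moreover have "\<forall>\<^sub>F t in sequentially. A t (v # xs) = Suc 0"
      using stage_approx_complete[OF f _ v0] xs by simp
    moreover have "\<forall>\<^sub>F t in sequentially. v < t"
      by (rule eventually_gt_at_top)
    ultimately show "\<forall>\<^sub>F t in sequentially. F t xs = Suc v"
    proof eventually_elim
      case (elim t)
      then have "Q t v xs"
        using less(2) by (auto simp: Q_def)
      moreover have "(LEAST y. Q t y xs \<or> t \<le> y) = v"
      proof (rule Least_equality)
        fix y assume y: "Q t y xs \<or> t \<le> y"
        show "v \<le> y"
        proof (rule ccontr)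
          assume "\<not> v \<le> y"
          then have "1 < A t (y # xs)"
            using elim(1) less(2)[of y] by simp
          with y \<open>\<not> v \<le> y\<close> elim(3) show False
            by (auto simp: Q_def)
        qed
      qed (use \<open>Q t v xs\<close> in simp)
      ultimately show ?case
        using elim(3) by (auto simp: F_def)
    qed
  qed
  then show ?thesis by blast
qed

lemma mu_recursive_stage_approx: "mu_recursive n f \<Longrightarrow> \<exists>F. stage_approx n f F"
proof (induction rule: mu_recursive.induct)
  case (zero n)
  then show ?case using stage_approx_total[OF total_recursive_const] by blast
next
  case succ
  have "total_recursive 1 (\<lambda>xs. Suc (xs ! 0))"
    by (intro recursive_intros) simp
  then show ?case using stage_approx_total by blast
next
  case (proj i n)
  then show ?case using stage_approx_total[OF total_recursive_nth(1)] by blast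
next
  case (comp fs g n)
  then show ?case using stage_approx_comp by meson
next
  case (prec n f g)
  then show ?case using stage_approx_prec by blast
next
  case (minim n f)
  then show ?case using stage_approx_minim by blast
qed

section \<open>Codes of finite sequences\<close>

lemma total_recursive_prod_encode [recursive_intros]:
  assumes "total_recursive n a" "total_recursive n b"
  shows "total_recursive n (\<lambda>xs. prod_encode (a xs, b xs))"
  unfolding prod_encode_def by (simp, intro recursive_intros assms)

lemma prod_decode_le: "prod_decode z = (x, y) \<Longrightarrow> x \<le> z \<and> y \<le> z"
  by (metis le_prod_encode_1 le_prod_encode_2 prod_decode_inverse)

text \<open>\<open>prod_encode\<close> is inverted by search. A component is at most the code, so
  the other component can be quantified with a bound and the test is decidable.\<close>

lemma total_recursive_prod_decode [recursive_intros]: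
  assumes "total_recursive n a"
  shows "total_recursive n (\<lambda>xs. fst (prod_decode (a xs)))"
    and "total_recursive n (\<lambda>xs. snd (prod_decode (a xs)))"
proof -
  have ex: "\<exists>y<Suc z. prod_encode (fst (prod_decode z), y) = z"
    "\<exists>x<Suc z. prod_encode (x, snd (prod_decode z)) = z" for z
    using prod_decode_le[of z "fst (prod_decode z)" "snd (prod_decode z)"]
    by (metis less_Suc_eq_le prod.collapse prod_decode_inverse)+
  have fst: "(LEAST x. \<exists>y<Suc z. prod_encode (x, y) = z) = fst (prod_decode z)" for z
    by (rule Least_equality) (use ex(1) in \<open>auto simp: prod_encode_inverse\<close>)
  have snd: "(LEAST y. \<exists>x<Suc z. prod_encode (x, y) = z) = snd (prod_decode z)" for z
    by (rule Least_equality) (use ex(2) in \<open>auto simp: prod_encode_inverse\<close>)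
  have "total_recursive n (\<lambda>xs. LEAST x. \<exists>y<Suc (a xs). prod_encode (x, y) = a xs)"
    by (rule total_recursive_Least)
      (use ex(1) in \<open>(blast | intro recursive_intros total_recursive_compose[OF assms] | simp)+\<close>)
  then show "total_recursive n (\<lambda>xs. fst (prod_decode (a xs)))"
    by (simp only: fst)
  have "total_recursive n (\<lambda>xs. LEAST y. \<exists>x<Suc (a xs). prod_encode (x, y) = a xs)"
    by (rule total_recursive_Least)
      (use ex(2) in \<open>(blast | intro recursive_intros total_recursive_compose[OF assms] | simp)+\<close>)
  then show "total_recursive n (\<lambda>xs. snd (prod_decode (a xs)))"
    by (simp only: snd)
qed

lemma recursive_pred_set_decode [recursive_intros]:
  assumes "total_recursive n a" "total_recursive n b"
  shows "recursive_pred n (\<lambda>xs. a xs \<in> set_decode (b xs))"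
  unfolding set_decode_def mem_Collect_eq by (intro recursive_intros assms)

section \<open>Lists accessed through their codes\<close>

definition code_drop :: "nat \<Rightarrow> nat \<Rightarrow> nat" where
  "code_drop s k = rec_nat s (\<lambda>i r. snd (prod_decode (r - 1))) k"

definition code_nth :: "nat \<Rightarrow> nat \<Rightarrow> nat" where
  "code_nth s k = fst (prod_decode (code_drop s k - 1))"

text \<open>A nonempty list is coded by the successor of a pair code, which the predecessor undoes.
  The code \<open>0\<close> of the empty list is mapped to itself, because \<open>0\<close> decodes
  to the pair \<open>(0, 0)\<close>, in agreement with \<open>tl [] = []\<close>.\<close>

lemma list_decode_tl: "list_decode (snd (prod_decode (s - 1))) = tl (list_decode s)"
proof (cases s)
  case 0
  have "prod_decode 0 = (0, 0)"
    using prod_encode_inverse[of "(0, 0)"] by (simp add: prod_encode_def)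
  with 0 show ?thesis by simp
qed (simp add: case_prod_beta)

lemma list_decode_code_drop: "list_decode (code_drop s k) = drop k (list_decode s)"
proof (induction k)
  case (Suc k)
  have "list_decode (code_drop s (Suc k)) = list_decode (snd (prod_decode (code_drop s k - 1)))"
    by (simp add: code_drop_def)
  also have "\<dots> = tl (list_decode (code_drop s k))"
    by (rule list_decode_tl)
  finally have "list_decode (code_drop s (Suc k)) = tl (list_decode (code_drop s k))" .
  with Suc show ?case by (simp add: drop_Suc tl_drop)
qed (simp add: code_drop_def)

lemma list_decode_eq_Nil: "list_decode s = [] \<longleftrightarrow> s = 0"
  by (cases s) (auto split: prod.splits)

lemma code_nth: "k < length (list_decode s) \<Longrightarrow> code_nth s k = list_decode s ! k"
proof -
  assume k: "k < length (list_decode s)"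
  then have "code_drop s k \<noteq> 0"
    using list_decode_code_drop[of s k] by (intro notI) simp
  then obtain m where m: "code_drop s k = Suc m"
    using not0_implies_Suc by blast
  have "list_decode s ! k = hd (list_decode (code_drop s k))"
    by (simp add: list_decode_code_drop hd_drop_conv_nth k)
  then show ?thesis
    by (simp add: m code_nth_def case_prod_beta)
qed

lemma total_recursive_code_drop [recursive_intros]:
  assumes "total_recursive n a" "total_recursive n b"
  shows "total_recursive n (\<lambda>xs. code_drop (a xs) (b xs))"
  unfolding code_drop_def by (intro recursive_intros assms) simp

lemma total_recursive_code_nth [recursive_intros]:
  assumes "total_recursive n a" "total_recursive n b"
  shows "total_recursive n (\<lambda>xs. code_nth (a xs) (b xs))"
  unfolding code_nth_def by (intro recursive_intros assms)

text \<open>Since only the empty list has code \<open>0\<close>, the length is the least number of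
  entries to drop before the code becomes \<open>0\<close>.\<close>

lemma total_recursive_length_list_decode [recursive_intros]:
  assumes "total_recursive n a"
  shows "total_recursive n (\<lambda>xs. length (list_decode (a xs)))"
proof (rule total_recursive_cong)
  have zero: "code_drop s k = 0 \<longleftrightarrow> length (list_decode s) \<le> k" for s k
    using list_decode_eq_Nil[of "code_drop s k"] by (simp add: list_decode_code_drop)
  show "total_recursive n (\<lambda>xs. LEAST k. code_drop (a xs) k = 0)"
    by (rule total_recursive_Least)
      (intro recursive_intros total_recursive_compose[OF assms], simp_all add: zero, blast)
  show "(LEAST k. code_drop (a xs) k = 0) = length (list_decode (a xs))" for xs
    unfolding zero by (rule Least_equality) auto
qed

lemma recursive_pred_prefix [recursive_intros]:
  assumes a: "total_recursive n a" and b: "total_recursive n b"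
  shows "recursive_pred n (\<lambda>xs. prefix (list_decode (a xs)) (list_decode (b xs)))"
proof (rule recursive_pred_cong)
  show "recursive_pred n (\<lambda>xs. length (list_decode (a xs)) \<le> length (list_decode (b xs)) \<and>
    (\<forall>k<length (list_decode (a xs)). code_nth (a xs) k = code_nth (b xs) k))"
    by (intro recursive_intros assms total_recursive_compose[OF a] total_recursive_compose[OF b]) simp_all
  have prefix_iff: "prefix us vs \<longleftrightarrow> length us \<le> length vs \<and> (\<forall>k<length us. us ! k = vs ! k)"
    for us vs :: "nat list"
  proof
    assume *: "length us \<le> length vs \<and> (\<forall>k<length us. us ! k = vs ! k)"
    then have "take (length us) vs = us"
      by (intro nth_equalityI) auto
    then show "prefix us vs"
      by (metis take_is_prefix)
  qed (auto simp: prefix_def nth_append)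
  show "length (list_decode (a xs)) \<le> length (list_decode (b xs)) \<and>
    (\<forall>k<length (list_decode (a xs)). code_nth (a xs) k = code_nth (b xs) k) \<longleftrightarrow>
    prefix (list_decode (a xs)) (list_decode (b xs))" for xs
    unfolding prefix_iff by (auto simp: code_nth)
qed

text \<open>The entries follow \<open>seq_code\<close>: \<open>0\<close> is the pause and
  \<open>Suc x\<close> the datum \<open>x\<close>.\<close>

definition code_content :: "nat \<Rightarrow> nat set" where
  "code_content s = {x. Suc x \<in> set (list_decode s)}"

lemma recursive_pred_code_content_subset [recursive_intros]:
  assumes a: "total_recursive n a" and b: "total_recursive n b"
  shows "recursive_pred n (\<lambda>xs. code_content (a xs) \<subseteq> set_decode (b xs))"
proof (rule recursive_pred_cong)
  show "recursive_pred n (\<lambda>xs. \<forall>k<length (list_decode (a xs)).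
      code_nth (a xs) k = 0 \<or> code_nth (a xs) k - 1 \<in> set_decode (b xs))"
    by (intro recursive_intros assms total_recursive_compose[OF a] total_recursive_compose[OF b]) simp_all
  have "code_content s \<subseteq> D \<longleftrightarrow> (\<forall>y\<in>set (list_decode s). y = 0 \<or> y - 1 \<in> D)" for s D
  proof
    assume "code_content s \<subseteq> D"
    then show "\<forall>y\<in>set (list_decode s). y = 0 \<or> y - 1 \<in> D"
      unfolding code_content_def by (metis Suc_pred' mem_Collect_eq neq0_conv subsetD)
  qed (force simp: code_content_def)
  then have "code_content s \<subseteq> D \<longleftrightarrow>
      (\<forall>k<length (list_decode s). code_nth s k = 0 \<or> code_nth s k - 1 \<in> D)" for s D
    by (simp add: all_set_conv_all_nth code_nth)
  then show "(\<forall>k<length (list_decode (a xs)).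
      code_nth (a xs) k = 0 \<or> code_nth (a xs) k - 1 \<in> set_decode (b xs)) \<longleftrightarrow>
    code_content (a xs) \<subseteq> set_decode (b xs)" for xs
    by blast
qed

text \<open>\<open>set_encode\<close> sums powers of two and so is monotone under inclusion. Being a
  minimum of codes of supersets, the code of a content can be found by search.\<close>

lemma set_encode_Least: "finite S \<Longrightarrow> set_encode S = (LEAST D. S \<subseteq> set_decode D)"
proof (rule sym, rule Least_equality)
  fix D assume "finite S" "S \<subseteq> set_decode D"
  then have "set_encode S \<le> set_encode (set_decode D)"
    unfolding set_encode_def by (intro sum_mono2) auto
  then show "set_encode S \<le> D" by simp
qed simp

lemma finite_code_content: "finite (code_content s)"
proof -
  have "code_content s \<subseteq> (\<lambda>x. x - 1) ` set (list_decode s)"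
    by (force simp: code_content_def)
  then show ?thesis by (rule finite_subset) simp
qed

lemma total_recursive_content [recursive_intros]:
  assumes "total_recursive n a"
  shows "total_recursive n (\<lambda>xs. set_encode (code_content (a xs)))"
  unfolding set_encode_Least[OF finite_code_content]
proof (rule total_recursive_Least)
  show "recursive_pred (Suc n) (\<lambda>ys. code_content (a (tl ys)) \<subseteq> set_decode (ys ! 0))"
    by (intro recursive_intros total_recursive_compose[OF assms]) simp
  show "\<exists>D. code_content (a xs) \<subseteq> set_decode D" for xs
    using set_encode_inverse[OF finite_code_content] by (metis order_refl)
qed

section \<open>Codes of sequences with pauses\<close>

lemma list_decode_seq_code: "list_decode (seq_code \<sigma>) = map (case_option 0 Suc) \<sigma>"
  by (simp add: seq_code_def)

text \<open>Undoing the shift entry by entry turns any list of numbers into a sequence with pauses.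
  Thus quantifiers over codes range over all sequences.\<close>

lemma seq_code_surj: "\<exists>\<sigma>. seq_code \<sigma> = s"
proof
  have "(case_option 0 Suc \<circ> case_nat None Some) = id"
    by (auto simp: fun_eq_iff split: nat.split)
  then show "seq_code (map (case_nat None Some) (list_decode s)) = s"
    by (simp add: seq_code_def)
qed

lemma code_content_seq_code: "code_content (seq_code \<sigma>) = content_seq \<sigma>"
  by (force simp: code_content_def content_seq_def list_decode_seq_code image_iff split: option.splits)

lemma prefix_seq_code:
  "prefix (list_decode (seq_code \<sigma>)) (list_decode (seq_code \<tau>)) \<longleftrightarrow> prefix \<sigma> \<tau>"
proof -
  have inj: "inj (case_option 0 Suc)"
    by (auto simp: inj_def split: option.splits)
  show ?thesis
    unfolding list_decode_seq_code
  proof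
    assume "prefix (map (case_option 0 Suc) \<sigma>) (map (case_option 0 Suc) \<tau>)"
    then obtain \<sigma>' where "prefix \<sigma>' \<tau>" "map (case_option 0 Suc) \<sigma> = map (case_option 0 Suc) \<sigma>'"
      using prefix_map_rightE by blast
    then show "prefix \<sigma> \<tau>"
      using inj by (simp add: inj_map_eq_map)
  qed (rule map_mono_prefix)
qed

section \<open>Passing between \<open>Rcomp\<close> and \<open>total_recursive\<close>\<close>

lemma RcompI:
  assumes "total_recursive 1 (\<lambda>xs. f (xs ! 0))"
  shows "(\<lambda>x. Some (f x)) \<in> Rcomp"
proof -
  obtain g where g: "mu_recursive 1 g" "\<And>xs. length xs = 1 \<Longrightarrow> g xs = Some (f (xs ! 0))"
    using assms unfolding total_recursive_def by blast
  from g(2) have "(\<lambda>x. Some (f x)) = (\<lambda>x. g [x])" by simp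
  with g(1) show ?thesis
    unfolding Rcomp_def Pcomp_def by blast
qed

lemma Rcomp_total_recursive:
  assumes "h \<in> Rcomp"
  shows "total_recursive 1 (\<lambda>xs. the (h (xs ! 0)))"
proof -
  obtain f where f: "mu_recursive 1 f" "h = (\<lambda>x. f [x])" and total: "\<And>x. h x \<noteq> None"
    using assms unfolding Rcomp_def Pcomp_def by blast
  have "f xs = Some (the (h (xs ! 0)))" if "length xs = 1" for xs
    using total[of "xs ! 0"] that unfolding f(2) by (cases xs) auto
  with f(1) show ?thesis
    by (rule total_recursiveI)
qed

section \<open>Texts and locking sequences\<close>

lemma length_initial_segment: "length (initial_segment T n) = n"
  by (simp add: initial_segment_def)

lemma content_initial_segment: "content_seq (initial_segment T n) \<subseteq> content T"
  by (auto simp: content_seq_def content_def initial_segment_def intro: rev_image_eqI)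

lemma finite_content_seq: "finite (content_seq \<sigma>)"
  using finite_code_content[of "seq_code \<sigma>"] by (simp add: code_content_seq_code)

lemma eventually_subset_content:
  assumes "finite A" "A \<subseteq> content T"
  shows "\<forall>\<^sub>F n in sequentially. A \<subseteq> content_seq (initial_segment T n)"
proof -
  have "\<forall>\<^sub>F n in sequentially. x \<in> content_seq (initial_segment T n)" if "x \<in> A" for x
  proof -
    obtain k where "T k = Some x"
      using assms(2) \<open>x \<in> A\<close> by (auto simp: content_def)
    then have "x \<in> content_seq (initial_segment T n)" if "k < n" for n
      using that by (force simp: content_seq_def initial_segment_def)
    then show ?thesis
      by (rule eventually_mono[OF eventually_gt_at_top])
  qed
  then have "\<forall>\<^sub>F n in sequentially. \<forall>x\<in>A. x \<in> content_seq (initial_segment T n)"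
    using assms(1) by (intro eventually_ball_finite) auto
  then show ?thesis
    by (simp add: subset_eq)
qed

lemma extend_to_text:
  assumes "content_seq \<sigma> \<subseteq> L"
  shows "\<exists>T. content T = L \<and> initial_segment T (length \<sigma>) = \<sigma>"
proof (intro exI conjI)
  \<comment> \<open>After \<open>\<sigma>\<close>, each \<open>x\<close> in \<open>L\<close> is
    presented at its own position \<open>length \<sigma> + x\<close>; the remaining positions are
    pauses.\<close>
  define T where "T n = (if n < length \<sigma> then \<sigma> ! n
    else if n - length \<sigma> \<in> L then Some (n - length \<sigma>) else None)" for n
  show "initial_segment T (length \<sigma>) = \<sigma>"
    by (auto simp: initial_segment_def T_def intro: nth_equalityI)
  show "content T = L"
  proof (intro set_eqI iffI)
    fix x assume "x \<in> content T"
    then obtain n where "T n = Some x" by (auto simp: content_def)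
    then show "x \<in> L"
      using assms by (auto simp: T_def content_seq_def in_set_conv_nth split: if_splits)
  next
    fix x assume "x \<in> L"
    then have "T (length \<sigma> + x) = Some x" by (simp add: T_def)
    then show "x \<in> content T" by (auto simp: content_def intro: rangeI[of T] sym)
  qed
qed

lemma prefix_chain_limit:
  assumes chain: "\<And>k. prefix (S k) (S (Suc k))" and len: "\<And>k. k \<le> length (S k)"
  shows "\<exists>T. \<forall>k \<sigma>. prefix \<sigma> (S k) \<longrightarrow> initial_segment T (length \<sigma>) = \<sigma>"
proof (intro exI allI impI)
  have mono: "prefix (S k) (S m)" if "k \<le> m" for k m
    using that by (induction rule: dec_induct) (auto intro: chain prefix_order.trans)
  fix k \<sigma> assume \<sigma>: "prefix \<sigma> (S k)"
  \<comment> \<open>Entry \<open>n\<close> of the limit is read from \<open>S (Suc n)\<close>, which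
    by \<open>len\<close> is long enough to have one.\<close>
  show "initial_segment (\<lambda>n. S (Suc n) ! n) (length \<sigma>) = \<sigma>"
  proof (rule nth_equalityI)
    fix i assume "i < length (initial_segment (\<lambda>n. S (Suc n) ! n) (length \<sigma>))"
    then have i: "i < length \<sigma>" by (simp add: length_initial_segment)
    let ?m = "max k (Suc i)"
    have "prefix \<sigma> (S ?m)" "prefix (S (Suc i)) (S ?m)"
      using \<sigma> mono[of k ?m] mono[of "Suc i" ?m] prefix_order.trans by auto
    moreover have "i < length (S (Suc i))"
      using len[of "Suc i"] by simp
    ultimately have "S (Suc i) ! i = \<sigma> ! i"
      using i by (metis prefix_def nth_append)
    then show "initial_segment (\<lambda>n. S (Suc n) ! n) (length \<sigma>) ! i = \<sigma> ! i"
      using i by (simp add: initial_segment_def)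
  qed (simp add: length_initial_segment)
qed

text \<open>The classical argument of Blum and Blum, for a partial \<open>M\<close>: without a
  locking sequence, every sequence over \<open>L\<close> has an extension over \<open>L\<close> that
  changes the hypothesis, unless \<open>M\<close> is undefined already. Iterating this while
  inserting all of \<open>L\<close> yields a text for \<open>L\<close> on which \<open>M\<close>
  does not converge.\<close>

lemma locking_sequence:
  assumes conv: "\<And>T. content T = L \<Longrightarrow> \<exists>n0 e. \<forall>n\<ge>n0. M (initial_segment T n) = Some e"
  shows "\<exists>\<sigma> e. content_seq \<sigma> \<subseteq> L \<and>
    (\<forall>\<tau>. prefix \<sigma> \<tau> \<longrightarrow> content_seq \<tau> \<subseteq> L \<longrightarrow> M \<tau> = Some e)"
proof (rule ccontr)
  assume no_lock: "\<not> ?thesis"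
  have "\<exists>\<tau>. prefix \<sigma> \<tau> \<and> content_seq \<tau> \<subseteq> L \<and> (M \<sigma> = None \<or> M \<tau> \<noteq> M \<sigma>)"
    if "content_seq \<sigma> \<subseteq> L" for \<sigma>
  proof (cases "M \<sigma>")
    case None
    \<comment> \<open>An undefined value already contradicts convergence, so \<open>\<sigma>\<close>
      may serve as its own extension.\<close>
    with that show ?thesis by blast
  next
    case (Some e)
    then show ?thesis
      using no_lock that by auto
  qed
  then obtain ext where ext: "\<And>\<sigma>. content_seq \<sigma> \<subseteq> L \<Longrightarrow> prefix \<sigma> (ext \<sigma>) \<and>
      content_seq (ext \<sigma>) \<subseteq> L \<and> (M \<sigma> = None \<or> M (ext \<sigma>) \<noteq> M \<sigma>)"
    by metis
  \<comment> \<open>Round \<open>k\<close> appends \<open>k\<close> if it belongs to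
    \<open>L\<close>, so that the limit is a text for all of \<open>L\<close>. The pause otherwise
    makes the sequence grow in every round.\<close>
  define S where "S = rec_nat [] (\<lambda>k \<sigma>. ext \<sigma> @ [if k \<in> L then Some k else None])"
  have S_Suc: "S (Suc k) = ext (S k) @ [if k \<in> L then Some k else None]" for k
    by (simp add: S_def)
  have S_content: "content_seq (S k) \<subseteq> L" for k
  proof (induction k)
    case 0
    show ?case by (simp add: S_def content_seq_def)
  next
    case (Suc k)
    then show ?case
      using ext[of "S k"] by (auto simp: S_Suc content_seq_def split: if_splits)
  qed
  note ext_S = ext[OF S_content]
  have len: "k \<le> length (S k)" for k
  proof (induction k)
    case (Suc k)
    then show ?case
      using ext_S[of k] by (auto simp: S_Suc dest: prefix_length_le)
  qed simp
  have ext_prefix: "prefix (ext (S k)) (S (Suc k))" for k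
    by (simp add: S_Suc)
  obtain T where T: "\<And>k \<sigma>. prefix \<sigma> (S k) \<Longrightarrow> initial_segment T (length \<sigma>) = \<sigma>"
    using prefix_chain_limit[of S, OF _ len] ext_S ext_prefix by (meson prefix_order.trans)
  have "content T = L"
  proof (intro set_eqI iffI)
    fix x assume "x \<in> content T"
    then obtain n where n: "T n = Some x" by (auto simp: content_def)
    have "n < length (S (Suc n))"
      using len[of "Suc n"] by simp
    then have "S (Suc n) ! n = Some x"
      using n T[of "S (Suc n)" "Suc n"] by (metis initial_segment_def nth_map_upt diff_zero add_0 prefix_order.refl)
    with \<open>n < length _\<close> show "x \<in> L"
      using S_content[of "Suc n"] nth_mem[of n "S (Suc n)"] by (auto simp: content_seq_def)
  next
    fix x assume "x \<in> L"
    then have "x \<in> content_seq (S (Suc x))"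
      by (simp add: content_seq_def S_Suc)
    then show "x \<in> content T"
      using content_initial_segment[of T "length (S (Suc x))"] T[of "S (Suc x)" "Suc x"] by auto
  qed
  from conv[OF this] obtain n0 e where e: "\<And>n. n0 \<le> n \<Longrightarrow> M (initial_segment T n) = Some e"
    by blast
  \<comment> \<open>Both \<open>S n0\<close> and its extension are initial segments of
    \<open>T\<close> of length at least \<open>n0\<close>, so both carry the limit hypothesis,
    against the choice of \<open>ext\<close>.\<close>
  have "M (S n0) = Some e"
    using e[OF len[of n0]] T[of "S n0" n0] by simp
  moreover have "M (ext (S n0)) = Some e"
    using e[of "length (ext (S n0))"] T[OF ext_prefix[of n0]] ext_S[of n0] len[of n0]
    by (auto dest: prefix_length_le)
  ultimately show False
    using ext_S[of n0] by simp
qed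

section \<open>The partially set-driven learner\<close>

text \<open>Only extensions on which a value has been found can refute \<open>s\<close>, since
  \<open>h\<close> may be undefined on others.\<close>

definition stable_at :: "(nat \<Rightarrow> nat \<Rightarrow> nat) \<Rightarrow> nat \<Rightarrow> nat set \<Rightarrow> nat \<Rightarrow> bool" where
  "stable_at H t D s \<longleftrightarrow> code_content s \<subseteq> D \<and> H t s \<noteq> 0 \<and>
     (\<forall>r<t. prefix (list_decode s) (list_decode r) \<longrightarrow> code_content r \<subseteq> D \<longrightarrow>
        H t r \<noteq> 0 \<longrightarrow> H t r = H t s)"

text \<open>The alternative \<open>t \<le> s\<close> makes the search total: the result is \<open>t\<close> if no code below \<open>t\<close> is
  stable.\<close>
definition least_stable :: "(nat \<Rightarrow> nat \<Rightarrow> nat) \<Rightarrow> nat \<Rightarrow> nat set \<Rightarrow> nat" where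
  "least_stable H t D = (LEAST s. stable_at H t D s \<or> t \<le> s)"

definition psd_learner :: "(nat \<Rightarrow> nat \<Rightarrow> nat) \<Rightarrow> nat \<Rightarrow> nat \<Rightarrow> nat set \<Rightarrow> nat" where
  "psd_learner H d t D =
     (if least_stable H t D < t then H t (least_stable H t D) - 1 else d)"

lemma total_recursive_psd_learner:
  assumes H: "\<And>n a b. total_recursive n a \<Longrightarrow> total_recursive n b \<Longrightarrow>
      total_recursive n (\<lambda>xs. H (a xs) (b xs))"
    and a: "total_recursive n a" and b: "total_recursive n b"
  shows "total_recursive n (\<lambda>xs. psd_learner H d (a xs) (set_decode (b xs)))"
proof -
  have least: "total_recursive n (\<lambda>xs. least_stable H (a xs) (set_decode (b xs)))"
    unfolding least_stable_def
  proof (rule total_recursive_Least)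
    show "recursive_pred (Suc n) (\<lambda>ys. stable_at H (a (tl ys)) (set_decode (b (tl ys))) (ys ! 0) \<or>
      a (tl ys) \<le> ys ! 0)"
      unfolding stable_at_def
      by (intro recursive_intros H total_recursive_compose[OF a] total_recursive_compose[OF b]) simp_all
  qed blast
  show ?thesis
    unfolding psd_learner_def by (intro recursive_intros H least a)
qed

lemma stable_at_least_stable:
  "least_stable H t D < t \<Longrightarrow> stable_at H t D (least_stable H t D)"
  using LeastI[of "\<lambda>s. stable_at H t D s \<or> t \<le> s" t] by (simp add: least_stable_def)

text \<open>The convergence argument uses just soundness and completeness of the stages;
  computability is treated in \<open>total_recursive_psd_learner\<close>.\<close>

locale stagewise_learner =
  fixes H :: "nat \<Rightarrow> nat \<Rightarrow> nat" and h :: "nat \<Rightarrow> nat option" and d :: nat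
  assumes sound: "H t s = Suc v \<Longrightarrow> h s = Some v"
    and complete: "h s = Some v \<Longrightarrow> \<forall>\<^sub>F t in sequentially. H t s = Suc v"
begin

lemma nonzero_sound: "H t s \<noteq> 0 \<Longrightarrow> h s = Some (H t s - 1)"
  by (rule sound[of t]) simp

text \<open>A stable candidate has a found value, which soundness makes a value of \<open>h\<close>.
  This is how \<open>CInd\<close> passes to the new learner.\<close>

lemma psd_learner_cases:
  "psd_learner H d t D = d \<or> (\<exists>s. code_content s \<subseteq> D \<and> h s = Some (psd_learner H d t D))"
proof (cases "least_stable H t D < t")
  case True
  then have "code_content (least_stable H t D) \<subseteq> D" "H t (least_stable H t D) \<noteq> 0"
    using stable_at_least_stable[of H t D] unfolding stable_at_def by blast+
  moreover from this have "h (least_stable H t D) = Some (psd_learner H d t D)"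
    using True nonzero_sound by (simp add: psd_learner_def)
  ultimately show ?thesis by blast
qed (simp add: psd_learner_def)

text \<open>The limit form of \<open>stable_at\<close>, with the whole language in place of the data
  seen and values of \<open>h\<close> in place of those found so far.\<close>

definition stable :: "nat set \<Rightarrow> nat \<Rightarrow> bool" where
  "stable L s \<longleftrightarrow> code_content s \<subseteq> L \<and> (\<exists>e. h s = Some e \<and>
     (\<forall>r v. prefix (list_decode s) (list_decode r) \<longrightarrow> code_content r \<subseteq> L \<longrightarrow> h r = Some v \<longrightarrow> v = e))"

text \<open>Once the content and the value of \<open>s\<close> have appeared, no refutation can
  arise: by soundness, any value found on an extension is a value of \<open>h\<close>, hence the
  stable one.\<close>

lemma eventually_stable_at:
  assumes "stable (content T) s"
  shows "\<forall>\<^sub>F n in sequentially. stable_at H n (content_seq (initial_segment T n)) s"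
proof -
  obtain e where s: "code_content s \<subseteq> content T" "h s = Some e"
    and e: "\<And>r v. prefix (list_decode s) (list_decode r) \<Longrightarrow> code_content r \<subseteq> content T \<Longrightarrow>
      h r = Some v \<Longrightarrow> v = e"
    using assms unfolding stable_def by blast
  show ?thesis
    using eventually_subset_content[OF finite_code_content s(1)] complete[OF s(2)]
  proof eventually_elim
    case (elim n)
    have "H n r = Suc e" if "prefix (list_decode s) (list_decode r)"
      "code_content r \<subseteq> content_seq (initial_segment T n)" "H n r \<noteq> 0" for r
    proof -
      have "H n r - 1 = e"
        using that content_initial_segment[of T n] by (intro e[of r] nonzero_sound) auto
      with that(3) show ?thesis by simp
    qed
    with elim show ?case
      by (simp add: stable_at_def)
  qed
qed

text \<open>If \<open>s\<close> has foreign content or \<open>h\<close> is undefined there,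
  soundness excludes it at every stage. Otherwise some extension \<open>r\<close> has a conflicting
  value, which is noticed once \<open>n\<close> exceeds \<open>r\<close>, the content of
  \<open>r\<close> has appeared and both values have been found.\<close>

lemma eventually_not_stable_at:
  assumes "\<not> stable (content T) s"
  shows "\<forall>\<^sub>F n in sequentially. \<not> stable_at H n (content_seq (initial_segment T n)) s"
proof (cases "code_content s \<subseteq> content T \<and> h s \<noteq> None")
  case False
  have "\<not> stable_at H n (content_seq (initial_segment T n)) s" for n
    using False content_initial_segment[of T n] nonzero_sound[of n s] unfolding stable_at_def
    by (metis order_trans option.distinct(1))
  then show ?thesis by simp
next
  case True
  then obtain e where e: "h s = Some e" by blast
  with True assms obtain r v where r: "prefix (list_decode s) (list_decode r)"
    "code_content r \<subseteq> content T" "h r = Some v" "v \<noteq> e"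
    unfolding stable_def by blast
  show ?thesis
    using eventually_subset_content[OF finite_code_content r(2)] complete[OF r(3)] complete[OF e]
      eventually_gt_at_top[of r]
  proof eventually_elim
    case (elim n)
    show ?case
    proof
      assume "stable_at H n (content_seq (initial_segment T n)) s"
      moreover have "H n r \<noteq> 0"
        using elim(2) by simp
      ultimately have "H n r = H n s"
        using elim(1,4) r(1) unfolding stable_at_def by blast
      with elim(2,3) r(4) show False by simp
    qed
  qed
qed

text \<open>A locking sequence serves only to show that some code is stable. The learner settles on
  the least stable code, as the finitely many smaller ones are all rejected eventually. The
  predicate \<open>correct\<close> keeps the numbering out of the argument.\<close>

lemma psd_learner_converges:
  assumes conv: "\<And>T. content T = L \<Longrightarrow>
      \<exists>n0 e. (\<forall>n\<ge>n0. h (seq_code (initial_segment T n)) = Some e) \<and> correct e"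
    and T: "content T = L"
  shows "\<exists>e. (\<forall>\<^sub>F n in sequentially. psd_learner H d n (content_seq (initial_segment T n)) = e) \<and> correct e"
proof -
  have "\<exists>\<sigma> e. content_seq \<sigma> \<subseteq> L \<and>
      (\<forall>\<tau>. prefix \<sigma> \<tau> \<longrightarrow> content_seq \<tau> \<subseteq> L \<longrightarrow> h (seq_code \<tau>) = Some e)"
    by (rule locking_sequence) (use conv in blast)
  then obtain \<sigma> e0 where \<sigma>: "content_seq \<sigma> \<subseteq> L"
    "\<And>\<tau>. prefix \<sigma> \<tau> \<Longrightarrow> content_seq \<tau> \<subseteq> L \<Longrightarrow> h (seq_code \<tau>) = Some e0"
    by blast
  have "v = e0" if "prefix (list_decode (seq_code \<sigma>)) (list_decode r)" "code_content r \<subseteq> L" "h r = Some v"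
    for r v
  proof -
    obtain \<tau> where "seq_code \<tau> = r"
      using seq_code_surj by blast
    with that \<sigma>(2)[of \<tau>] show ?thesis
      by (auto simp: prefix_seq_code code_content_seq_code)
  qed
  moreover have "code_content (seq_code \<sigma>) \<subseteq> L" "h (seq_code \<sigma>) = Some e0"
    using \<sigma> by (simp_all add: code_content_seq_code)
  ultimately have "stable L (seq_code \<sigma>)"
    unfolding stable_def by blast
  define s where "s = (LEAST s. stable L s)"
  have s: "stable L s"
    unfolding s_def using \<open>stable L (seq_code \<sigma>)\<close> by (rule LeastI)
  then obtain e where e: "code_content s \<subseteq> L" "h s = Some e"
    "\<And>r v. prefix (list_decode s) (list_decode r) \<Longrightarrow> code_content r \<subseteq> L \<Longrightarrow> h r = Some v \<Longrightarrow> v = e"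
    unfolding stable_def by blast
  txt \<open>A stable sequence need not be locking, since \<open>h\<close> may be undefined on some of its extensions;
    but \<open>h\<close> converges on a text through it, and the limit must be the stable value.\<close>
  have "correct e"
  proof -
    obtain \<rho> where \<rho>: "seq_code \<rho> = s"
      using seq_code_surj by blast
    then obtain T' where T': "content T' = L" "initial_segment T' (length \<rho>) = \<rho>"
      using extend_to_text[of \<rho> L] e(1) by (auto simp: code_content_seq_code)
    obtain n0 e' where e': "\<And>n. n0 \<le> n \<Longrightarrow> h (seq_code (initial_segment T' n)) = Some e'" "correct e'"
      using conv[OF T'(1)] by blast
    \<comment> \<open>This length lies beyond both \<open>\<rho>\<close> and the point of
      convergence on \<open>T'\<close>.\<close>
    let ?\<tau> = "initial_segment T' (length \<rho> + n0)"
    have "?\<tau> = initial_segment T' (length \<rho>) @ map T' [length \<rho>..<length \<rho> + n0]"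
      unfolding initial_segment_def using upt_add_eq_append[of 0 "length \<rho>" n0] by simp
    then have "prefix \<rho> ?\<tau>"
      unfolding T'(2) by (simp add: prefix_def)
    then have "e' = e"
      using e(3)[of "seq_code ?\<tau>" e'] e'(1)[of "length \<rho> + n0"] content_initial_segment[of T' "length \<rho> + n0"]
      unfolding \<rho>[symmetric] prefix_seq_code code_content_seq_code T'(1) by simp
    with e'(2) show ?thesis by simp
  qed
  have "\<forall>\<^sub>F n in sequentially. \<not> stable_at H n (content_seq (initial_segment T n)) r" if "r < s" for r
    using eventually_not_stable_at[of T r] not_less_Least[of r "stable L"] that T by (simp add: s_def)
  then have "\<forall>\<^sub>F n in sequentially. \<forall>r\<in>{..<s}. \<not> stable_at H n (content_seq (initial_segment T n)) r"
    by (intro eventually_ball_finite) auto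
  moreover have "\<forall>\<^sub>F n in sequentially. stable_at H n (content_seq (initial_segment T n)) s"
    using eventually_stable_at[of T s] s T by simp
  ultimately have "\<forall>\<^sub>F n in sequentially. psd_learner H d n (content_seq (initial_segment T n)) = e"
    using complete[OF e(2)] eventually_gt_at_top[of s]
  proof eventually_elim
    case (elim n)
    have "least_stable H n (content_seq (initial_segment T n)) = s"
      unfolding least_stable_def
    proof (rule Least_equality)
      show "s \<le> y" if "stable_at H n (content_seq (initial_segment T n)) y \<or> n \<le> y" for y
        using that elim(1,4) by (intro leI) auto
    qed (use elim(2) in simp)
    with elim show ?case
      by (simp add: psd_learner_def)
  qed
  with \<open>correct e\<close> show ?thesis by blast
qed

end

section \<open>The two simulations and the equality of the classes\<close>

lemma Ex_C_eventually:
  "Ex_C \<phi> p T \<longleftrightarrow> (\<exists>e. (\<forall>\<^sub>F n in sequentially. p n = Some e) \<and> C_index \<phi> e \<and> C_set \<phi> e = content T)"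
  unfolding Ex_C_def eventually_sequentially by (metis order_refl)

text \<open>The zero function has an index because \<open>range \<phi> = Pcomp\<close>. Such an
  index is the default output of the set-driven learner and respects \<open>CInd\<close>.\<close>

lemma ex_constant_C_index:
  assumes "acceptable \<phi>"
  shows "\<exists>d. C_index \<phi> d"
proof -
  have "(\<lambda>x. Some 0) \<in> Pcomp"
    using RcompI[OF total_recursive_const[of 1 0]] by (simp add: Rcomp_def)
  then obtain d where "\<phi> d = (\<lambda>x. Some 0)"
    using assms unfolding acceptable_def by (metis imageE)
  then have "C_index \<phi> d"
    by (simp add: C_index_def)
  then show ?thesis by blast
qed

text \<open>Content and length can be computed from the code of an initial segment. The hypothesis
  sequences agree on every text, so every restriction is preserved.\<close>

lemma full_information_simulates_set_driven:
  assumes "h \<in> Rcomp"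
  shows "\<exists>g\<in>Pcomp. \<forall>T. G g T = Psd h T"
proof
  let ?g = "\<lambda>s. Some (the (h (prod_encode (set_encode (code_content s), length (list_decode s)))))"
  have "recursive_vector 1 1
      (\<lambda>xs. [prod_encode (set_encode (code_content (xs ! 0)), length (list_decode (xs ! 0)))])"
    unfolding One_nat_def by (intro recursive_intros) simp_all
  from total_recursive_compose[OF Rcomp_total_recursive[OF assms] this]
  have "?g \<in> Rcomp"
    by (intro RcompI) simp
  then show "?g \<in> Pcomp"
    by (simp add: Rcomp_def)
  have "h x \<noteq> None" for x
    using assms by (simp add: Rcomp_def)
  then show "\<forall>T. G ?g T = Psd h T"
    by (auto simp: fun_eq_iff G_def Psd_def code_content_seq_code list_decode_seq_code length_initial_segment)
qed

text \<open>On a text \<open>T\<close> the new learner consults \<open>h\<close> on sequences that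
  occur in other texts of the same content, hence the premises about all \<open>T'\<close>. In this
  form the \<open>CInd\<close> part serves both as a demand on every text and as a demand on texts
  for a learned language.\<close>

lemma set_driven_simulates_full_information:
  assumes "acceptable \<phi>" "h \<in> Pcomp"
  shows "\<exists>g\<in>Rcomp.
    (\<forall>T. (\<forall>T'. content T' = content T \<longrightarrow> CInd \<phi> (G h T') T') \<longrightarrow> CInd \<phi> (Psd g T) T) \<and>
    (\<forall>T. (\<forall>T'. content T' = content T \<longrightarrow> Ex_C \<phi> (G h T') T') \<longrightarrow> Ex_C \<phi> (Psd g T) T)"
proof -
  obtain f where f: "mu_recursive 1 f" "h = (\<lambda>x. f [x])"
    using assms(2) unfolding Pcomp_def by blast
  obtain F where F: "stage_approx 1 f F"
    using mu_recursive_stage_approx[OF f(1)] by blast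
  obtain d where d: "C_index \<phi> d"
    using ex_constant_C_index[OF assms(1)] by blast
  define H where "H t s = F t [s]" for t s
  interpret stagewise_learner H h d
  proof
    show "H t s = Suc v \<Longrightarrow> h s = Some v" for t s v
      using stage_approx_sound[OF F, of "[s]" t v] by (simp add: H_def f(2))
    show "h s = Some v \<Longrightarrow> \<forall>\<^sub>F t in sequentially. H t s = Suc v" for s v
      using stage_approx_complete[OF F, of "[s]" v] by (simp add: H_def f(2))
  qed
  define g where "g x = psd_learner H d (snd (prod_decode x)) (set_decode (fst (prod_decode x)))" for x
  have H: "total_recursive n (\<lambda>xs. H (a xs) (b xs))" if "total_recursive n a" "total_recursive n b" for n a b
    unfolding H_def
    by (rule stage_approx_compose[OF F that(1)]) (simp, intro recursive_intros that(2))
  have "(\<lambda>x. Some (g x)) \<in> Rcomp"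
    unfolding g_def
    by (intro RcompI total_recursive_psd_learner H recursive_intros) simp_all
  moreover have Psd: "Psd (\<lambda>x. Some (g x)) T n =
      Some (psd_learner H d n (content_seq (initial_segment T n)))" for T n
    by (simp add: Psd_def g_def finite_content_seq)
  moreover have "CInd \<phi> (Psd (\<lambda>x. Some (g x)) T) T"
    if "\<forall>T'. content T' = content T \<longrightarrow> CInd \<phi> (G h T') T'" for T
  proof -
    \<comment> \<open>A sequence over the content of \<open>T\<close> begins some text of the same
      content, where the value of \<open>h\<close> is one of the hypotheses covered by the
      premise.\<close>
    have "C_index \<phi> v" if s: "code_content s \<subseteq> content T" "h s = Some v" for s v
    proof -
      obtain \<sigma> where \<sigma>: "seq_code \<sigma> = s"
        using seq_code_surj by blast
      then obtain T' where "content T' = content T" "initial_segment T' (length \<sigma>) = \<sigma>"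
        using extend_to_text[of \<sigma> "content T"] s(1) by (auto simp: code_content_seq_code)
      then show ?thesis
        using \<open>\<forall>T'. _\<close> s(2) \<sigma> unfolding CInd_def G_def by (metis option.inject)
    qed
    then have "C_index \<phi> (psd_learner H d n (content_seq (initial_segment T n)))" for n
      using psd_learner_cases[of n "content_seq (initial_segment T n)"] content_initial_segment[of T n] d
      by (metis order_trans)
    then show ?thesis
      by (simp add: CInd_def Psd)
  qed
  moreover have "Ex_C \<phi> (Psd (\<lambda>x. Some (g x)) T) T"
    if "\<forall>T'. content T' = content T \<longrightarrow> Ex_C \<phi> (G h T') T'" for T
  proof -
    have "\<exists>n0 e. (\<forall>n\<ge>n0. h (seq_code (initial_segment T' n)) = Some e) \<and>
        C_index \<phi> e \<and> C_set \<phi> e = content T" if "content T' = content T" for T'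
      using \<open>\<forall>T'. _\<close> that unfolding Ex_C_eventually eventually_sequentially G_def by metis
    from psd_learner_converges[of "content T" "\<lambda>e. C_index \<phi> e \<and> C_set \<phi> e = content T", OF this refl]
    show ?thesis
      by (simp add: Ex_C_eventually Psd)
  qed
  ultimately show ?thesis by blast
qed

theorem theorem3:
  fixes \<phi> :: "nat \<Rightarrow> nat \<Rightarrow> nat option"
    and \<delta> \<delta>' :: restriction
  assumes "acceptable \<phi>"
    and "\<delta> \<in> {CInd \<phi>, Unrestricted}"
    and "\<delta>' \<in> {CInd \<phi>, Unrestricted}"
  shows "Txt_REC \<delta> Pcomp G (restr_conj \<delta>' (Ex_C \<phi>))
       = Txt_REC \<delta> Rcomp Psd (restr_conj \<delta>' (Ex_C \<phi>))"
proof (rule antisym)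
  show "Txt_REC \<delta> Rcomp Psd (restr_conj \<delta>' (Ex_C \<phi>)) \<subseteq> Txt_REC \<delta> Pcomp G (restr_conj \<delta>' (Ex_C \<phi>))"
  proof
    fix \<L> assume "\<L> \<in> Txt_REC \<delta> Rcomp Psd (restr_conj \<delta>' (Ex_C \<phi>))"
    then obtain h where h: "\<L> \<subseteq> REC" "h \<in> Rcomp"
      "\<forall>L\<in>\<L>. learns \<delta> Psd (restr_conj \<delta>' (Ex_C \<phi>)) h L"
      unfolding Txt_REC_def by blast
    obtain g where "g \<in> Pcomp" "\<And>T. G g T = Psd h T"
      using full_information_simulates_set_driven[OF h(2)] by blast
    then have "\<forall>L\<in>\<L>. learns \<delta> G (restr_conj \<delta>' (Ex_C \<phi>)) g L"
      using h(3) by (simp add: learns_def)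
    with h(1) \<open>g \<in> Pcomp\<close> show "\<L> \<in> Txt_REC \<delta> Pcomp G (restr_conj \<delta>' (Ex_C \<phi>))"
      unfolding Txt_REC_def by blast
  qed
  show "Txt_REC \<delta> Pcomp G (restr_conj \<delta>' (Ex_C \<phi>)) \<subseteq> Txt_REC \<delta> Rcomp Psd (restr_conj \<delta>' (Ex_C \<phi>))"
  proof
    fix \<L> assume "\<L> \<in> Txt_REC \<delta> Pcomp G (restr_conj \<delta>' (Ex_C \<phi>))"
    then obtain h where h: "\<L> \<subseteq> REC" "h \<in> Pcomp"
      "\<forall>L\<in>\<L>. learns \<delta> G (restr_conj \<delta>' (Ex_C \<phi>)) h L"
      unfolding Txt_REC_def by blast
    obtain g where g: "g \<in> Rcomp"
      and CInd: "\<And>T. (\<And>T'. content T' = content T \<Longrightarrow> CInd \<phi> (G h T') T') \<Longrightarrow> CInd \<phi> (Psd g T) T"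
      and Ex: "\<And>T. (\<And>T'. content T' = content T \<Longrightarrow> Ex_C \<phi> (G h T') T') \<Longrightarrow> Ex_C \<phi> (Psd g T) T"
      using set_driven_simulates_full_information[OF assms(1) h(2)] by blast
    have "learns \<delta> Psd (restr_conj \<delta>' (Ex_C \<phi>)) g L" if "L \<in> \<L>" for L
    proof -
      have \<delta>: "\<And>T. \<delta> (G h T) T" and \<delta>': "\<And>T. content T = L \<Longrightarrow> \<delta>' (G h T) T"
        and "\<And>T. content T = L \<Longrightarrow> Ex_C \<phi> (G h T) T"
        using h(3) that unfolding learns_def restr_conj_def text_for_def by blast+
      then have "Ex_C \<phi> (Psd g T) T" if "content T = L" for T
        using that Ex by blast
      \<comment> \<open>\<open>\<delta>\<close> is known on every text, so the premise holds for any
        content. For \<open>\<delta>'\<close> it is known only on texts for \<open>L\<close>, which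
        suffices because all texts compared have that content.\<close>
      moreover have "\<delta> (Psd g T) T" for T
        using assms(2) \<delta> CInd[of T] by (auto simp: Unrestricted_def)
      moreover have "\<delta>' (Psd g T) T" if "content T = L" for T
        using assms(3) \<delta>' CInd[of T] that by (auto simp: Unrestricted_def)
      ultimately show ?thesis
        unfolding learns_def restr_conj_def text_for_def by blast
    qed
    with h(1) g show "\<L> \<in> Txt_REC \<delta> Rcomp Psd (restr_conj \<delta>' (Ex_C \<phi>))"
      unfolding Txt_REC_def by blast
  qed
qed

end
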